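(* Let $\boldsymbol{\Upsilon}_{\mathbf{HGP}}:\mathbf{HGP}\to\mathbf{WQSym}$ be the linear map sending a hypergraphic polytope $\mathfrak{q}\subseteq\mathbb{R}^n$ to $\boldsymbol{\Upsilon}_{\mathbf{HGP}}(\mathfrak{q})=\sum_f\mathbf{a}_{f(1)}\cdots\mathbf{a}_{f(n)}$, the sum running over all $\mathfrak{q}$-generic functions $f:[n]\to\mathbb{N}$. Then the linear space $\ker\boldsymbol{\Upsilon}_{\mathbf{HGP}}$ is generated (spanned) by the simple relations and the modular relations on hypergraphic polytopes. The image of $\boldsymbol{\Upsilon}_{\mathbf{HGP}}$ is $\mathbf{SC}$, which is a proper subspace of $\mathbf{WQSym}$.
   Context: $\mathbb{K}$ is a field of characteristic zero; $\mathbb{N}=\{1,2,\dots\}$, $[n]=\{1,\dots,n\}$; $\{\mathbf{a}_i\}_{i\ge1}$ are non-commuting variables. Polytopes. For non-empty $J\subseteq[n]$ let $\mathfrak{s}_J=\mathrm{conv}\{e_j : j\in J\}\subseteq\mathbb{R}^n$. A hypergraphic polytope in $\mathbb{R}^n$ is a Minkowski sum $\mathfrak{q}=\sum_{\emptyset\ne J\subseteq[n]}a_J\mathfrak{s}_J$ with real $a_J\ge0$ (the empty sum is $\{0\}$). The $a_J$ are determined by $\mathfrak{q}$, and $\mathcal{F}(\mathfrak{q})=\{J : a_J>0\}$. For a family $\mathcal{A}$ of non-empty subsets of $[n]$, $\mathcal{F}^{-1}(\mathcal{A})=\sum_{J\in\mathcal{A}}\mathfrak{s}_J$. $\mathbf{HGP}=\bigoplus_{n\ge0}\mathbf{HGP}_n$,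 with $\mathbf{HGP}_n$ the $\mathbb{K}$-vector space freely generated by the hypergraphic polytopes in $\mathbb{R}^n$. A function $f:[n]\to\mathbb{N}$ is $\mathfrak{q}$-generic if the face of $\mathfrak{q}$ on which $x\mapsto\sum_i f(i)x_i$ is minimized is a point. Set compositions. $\mathbf{C}_n$ is the set of set compositions $\vec{\boldsymbol{\pi}}=S_1|\cdots|S_k$ of $[n]$ (ordered lists of non-empty disjoint sets with union $[n]$). For non-empty $A\subseteq[n]$, $A_{\vec{\boldsymbol{\pi}}}=A\cap S_i$ with $i$ the smallest index such that $A\cap S_i\neq\emptyset$. For $f:[n]\to\mathbb{N}$, $\vec{\boldsymbol{\pi}}(f)$ is obtained from $f^{-1}(1)|f^{-1}(2)|\cdots$ by deleting empty sets. $\mathbf{M}_{\vec{\boldsymbol{\pi}}}=\sum_{f:\,\vec{\boldsymbol{\pi}}(f)=\vec{\boldsymbol{\pi}}}\mathbf{a}_{f(1)}\cdots\mathbf{a}_{f(n)}$; $\mathbf{WQSym}_n$ is the $\mathbb{K}$-span of $\{\mathbf{M}_{\vec{\boldsymbol{\pi}}}\}_{\vec{\boldsymbol{\pi}}\in\mathbf{C}_n}$ and $\mathbf{WQSym}=\bigoplus_{n\ge 0}\mathbf{WQSym}_n$. The space $\mathbf{SC}$. On $\mathbf{C}_n$ set $\vec{\boldsymbol{\pi}}\sim\vec{\boldsymbol{\tau}}$ if for every non-empty $A\subseteq[n]$: $\#A_{\vec{\boldsymbol{\pi}}}=1\Leftrightarrow\#A_{\vec{\boldsymbol{\tau}}}=1$.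 Let $\mathbf{N}_{[\vec{\boldsymbol{\pi}}]}=\sum_{\vec{\boldsymbol{\tau}}\sim\vec{\boldsymbol{\pi}}}\mathbf{M}_{\vec{\boldsymbol{\tau}}}$. $\mathbf{SC}$ is the span of all $\mathbf{N}_{[\vec{\boldsymbol{\pi}}]}$, $[\vec{\boldsymbol{\pi}}]\in\mathbf{C}_n/\!\sim$, $n\ge0$. Relations. A simple relation is $\mathfrak{q}_1-\mathfrak{q}_2\in\mathbf{HGP}$ (formal difference) with $\mathfrak{q}_1,\mathfrak{q}_2$ hypergraphic polytopes in the same $\mathbb{R}^n$ and $\mathcal{F}(\mathfrak{q}_1)=\mathcal{F}(\mathfrak{q}_2)$. For non-empty $A\subseteq[n]$ let $\mathrm{Orth}\,A=\{\vec{\boldsymbol{\pi}}\in\mathbf{C}_n : \#A_{\vec{\boldsymbol{\pi}}}=1\}$. Given disjoint families $\mathcal{A},\mathcal{B}$ of non-empty subsets of $[n]$ with $\bigcup_{A\in\mathcal{A}}(\mathrm{Orth}\,A)^c\cup\bigcup_{B\in\mathcal{B}}\mathrm{Orth}\,B=\mathbf{C}_n$, the corresponding modular relation is the formal linear combination $\sum_{\mathcal{T}\subseteq\mathcal{B}}(-1)^{\#\mathcal{T}}\big[\mathcal{F}^{-1}(\mathcal{A})+\mathcal{F}^{-1}(\mathcal{T})\big]\in\mathbf{HGP}_n$, where the sum inside the brackets is a Minkowski sum. *)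

theory Defs
  imports
    "HOL-Analysis.Analysis"
    "HOL-Library.Function_Algebras"
    "HOL-Library.Set_Algebras"
    "HOL-Analysis.Finite_Function_Topology"
begin

section \<open>Two vector spaces over a field\<close>

definition free_scale :: "'k \<Rightarrow> ('a \<Rightarrow>\<^sub>0 'k) \<Rightarrow> ('a \<Rightarrow>\<^sub>0 'k::field)" where
  "free_scale c v = Poly_Mapping.map ((*) c) v"

lemma lookup_free_scale:
  "Poly_Mapping.lookup (free_scale c v) b = c * Poly_Mapping.lookup v b"
  by (simp add: free_scale_def Poly_Mapping.map.rep_eq when_def)

interpretation free: vector_space free_scale
  by unfold_locales
    (auto intro!: poly_mapping_eqI simp: lookup_free_scale lookup_add algebra_simps)

text \<open>
  A formal power series in the non-commuting variables \<open>a\<^sub>1, a\<^sub>2, \<dots>\<close> is the function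
  sending a word \<open>[i\<^sub>1, \<dots>, i\<^sub>n]\<close> to the coefficient of \<open>a\<^bsub>i\<^sub>1\<^esub> \<cdots> a\<^bsub>i\<^sub>n\<^esub>\<close>.
\<close>

type_synonym 'k series = "nat list \<Rightarrow> 'k"

definition series_scale :: "'k \<Rightarrow> 'k series \<Rightarrow> 'k::field series" where
  "series_scale c F = (\<lambda>w. c * F w)"

interpretation series: vector_space series_scale
  by unfold_locales (auto simp: series_scale_def fun_eq_iff algebra_simps)


section \<open>Functions and formal sums of monomials\<close>

text \<open>The functions from \<open>[n]\<close> to the positive integers, extended by \<open>undefined\<close>.\<close>

definition colorings :: "nat \<Rightarrow> (nat \<Rightarrow> nat) set" where
  "colorings n = ({1..n} \<rightarrow>\<^sub>E {1..})"

definition word :: "nat \<Rightarrow> (nat \<Rightarrow> nat) \<Rightarrow> nat list" where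
  "word n f = map f [1..<Suc n]"

text \<open>
  The possibly infinite sum of the monomials \<open>a\<^bsub>f(1)\<^esub> \<cdots> a\<^bsub>f(n)\<^esub>\<close> over \<open>f \<in> S\<close>: the coefficient of
  a word counts the \<open>f\<close> that produce it. At most one coloring of \<open>[n]\<close> produces a given word.
\<close>

definition monomial_sum :: "nat \<Rightarrow> (nat \<Rightarrow> nat) set \<Rightarrow> 'k::field series" where
  "monomial_sum n S = (\<lambda>w. of_nat (card {f \<in> S. word n f = w}))"


section \<open>Hypergraphic polytopes\<close>

text \<open>
  Points of \<open>\<real>\<^sup>n\<close> are the finitely supported \<open>x :: nat \<Rightarrow>\<^sub>0 real\<close> with support in \<open>{1..n}\<close>.
  The sum of sets is the Minkowski sum, with neutral element \<open>{0}\<close>.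
\<close>

definition nonempty_subsets :: "nat \<Rightarrow> nat set set" where
  "nonempty_subsets n = Pow {1..n} - {{}}"

definition simplex_face :: "nat set \<Rightarrow> (nat \<Rightarrow>\<^sub>0 real) set" where
  "simplex_face J = convex hull ((\<lambda>j. Poly_Mapping.single j 1) ` J)"

definition hypergraphic_coeffs ::
    "nat \<Rightarrow> (nat \<Rightarrow>\<^sub>0 real) set \<Rightarrow> (nat set \<Rightarrow> real) \<Rightarrow> bool" where
  "hypergraphic_coeffs n q a \<longleftrightarrow>
     (\<forall>J \<in> nonempty_subsets n. 0 \<le> a J) \<and> (\<forall>J. J \<notin> nonempty_subsets n \<longrightarrow> a J = 0) \<and>
     q = (\<Sum>J \<in> nonempty_subsets n. (*\<^sub>R) (a J) ` simplex_face J)"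

definition hypergraphic :: "nat \<Rightarrow> (nat \<Rightarrow>\<^sub>0 real) set \<Rightarrow> bool" where
  "hypergraphic n q \<longleftrightarrow> (\<exists>a. hypergraphic_coeffs n q a)"

text \<open>The coefficients of a hypergraphic polytope are unique.\<close>

definition supp_family :: "nat \<Rightarrow> (nat \<Rightarrow>\<^sub>0 real) set \<Rightarrow> nat set set" where
  "supp_family n q = {J. 0 < (THE a. hypergraphic_coeffs n q a) J}"

definition family_polytope :: "nat set set \<Rightarrow> (nat \<Rightarrow>\<^sub>0 real) set" where
  "family_polytope \<A> = (\<Sum>J\<in>\<A>. simplex_face J)"

text \<open>
  The basis elements carry the dimension \<open>n\<close> of the ambient space, since the same set of
  finitely supported functions may represent polytopes in several \<open>\<real>\<^sup>n\<close>, which are distinct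
  basis elements.
\<close>

type_synonym 'k polytope_comb = "(nat \<times> (nat \<Rightarrow>\<^sub>0 real) set) \<Rightarrow>\<^sub>0 'k"

definition HGP :: "'k::field polytope_comb set" where
  "HGP = {v. \<forall>(n, q) \<in> Poly_Mapping.keys v. hypergraphic n q}"

definition polytope_basis :: "nat \<Rightarrow> (nat \<Rightarrow>\<^sub>0 real) set \<Rightarrow> 'k::field polytope_comb" where
  "polytope_basis n q = Poly_Mapping.single (n, q) 1"

definition min_face :: "nat \<Rightarrow> (nat \<Rightarrow> nat) \<Rightarrow> (nat \<Rightarrow>\<^sub>0 real) set \<Rightarrow> (nat \<Rightarrow>\<^sub>0 real) set" where
  "min_face n f q = {x \<in> q. \<forall>y \<in> q.
     (\<Sum>i\<in>{1..n}. real (f i) * Poly_Mapping.lookup x i)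
       \<le> (\<Sum>i\<in>{1..n}. real (f i) * Poly_Mapping.lookup y i)}"

definition generic :: "nat \<Rightarrow> (nat \<Rightarrow>\<^sub>0 real) set \<Rightarrow> (nat \<Rightarrow> nat) \<Rightarrow> bool" where
  "generic n q f \<longleftrightarrow> is_singleton (min_face n f q)"

definition chromatic_series :: "nat \<Rightarrow> (nat \<Rightarrow>\<^sub>0 real) set \<Rightarrow> 'k::field series" where
  "chromatic_series n q = monomial_sum n {f \<in> colorings n. generic n q f}"

definition Upsilon :: "'k::field polytope_comb \<Rightarrow> 'k series" where
  "Upsilon v = (\<Sum>(n, q) \<in> Poly_Mapping.keys v.
     series_scale (Poly_Mapping.lookup v (n, q)) (chromatic_series n q))"

lemma Upsilon_basis: "Upsilon (polytope_basis n q) = chromatic_series n q"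
  by (simp add: Upsilon_def polytope_basis_def series_scale_def)

lemma Upsilon_superset:
  assumes "finite B" "Poly_Mapping.keys v \<subseteq> B"
  shows "Upsilon v = (\<Sum>(n, q) \<in> B.
     series_scale (Poly_Mapping.lookup v (n, q)) (chromatic_series n q))"
  unfolding Upsilon_def using assms
  by (intro sum.mono_neutral_left)
    (auto simp: in_keys_iff series_scale_def zero_fun_def)

lemma linear_Upsilon: "Vector_Spaces.linear free_scale series_scale Upsilon"
proof (unfold_locales, goal_cases)
  case (1 v w)
  let ?B = "Poly_Mapping.keys v \<union> Poly_Mapping.keys w"
  have "Poly_Mapping.keys (v + w) \<subseteq> ?B"
    by (rule Poly_Mapping.keys_add)
  then show ?case
    by (subst (1 2 3) Upsilon_superset[of ?B])
      (auto simp: lookup_add series.scale_left_distrib sum.distrib case_prod_unfold)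
next
  case (2 c v)
  have "Poly_Mapping.keys (free_scale c v) \<subseteq> Poly_Mapping.keys v"
    by (auto simp: in_keys_iff lookup_free_scale)
  then show ?case
    by (subst (1 2) Upsilon_superset[of "Poly_Mapping.keys v"])
      (auto simp: lookup_free_scale series.scale_sum_right case_prod_unfold)
qed


section \<open>Set compositions, \<open>WQSym\<close> and \<open>SC\<close>\<close>

definition set_compositions :: "nat \<Rightarrow> nat set list set" where
  "set_compositions n =
     {\<pi>. {} \<notin> set \<pi> \<and> sorted_wrt disjnt \<pi> \<and> \<Union>(set \<pi>) = {1..n}}"

text \<open>The intersection of \<open>A\<close> with the first block of \<open>\<pi>\<close> that meets \<open>A\<close>.\<close>

definition first_part :: "nat set \<Rightarrow> nat set list \<Rightarrow> nat set" where
  "first_part A \<pi> = A \<inter> \<pi> ! (LEAST i. i < length \<pi> \<and> A \<inter> \<pi> ! i \<noteq> {})"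

text \<open>Only the values actually taken by \<open>f\<close> have a non-empty fibre.\<close>

definition comp_of :: "nat \<Rightarrow> (nat \<Rightarrow> nat) \<Rightarrow> nat set list" where
  "comp_of n f =
     map (\<lambda>v. {i \<in> {1..n}. f i = v}) (sorted_list_of_set (f ` {1..n}))"

definition M_series :: "nat \<Rightarrow> nat set list \<Rightarrow> 'k::field series" where
  "M_series n \<pi> = monomial_sum n {f \<in> colorings n. comp_of n f = \<pi>}"

definition WQSym_deg :: "nat \<Rightarrow> 'k::field series set" where
  "WQSym_deg n = series.span (M_series n ` set_compositions n)"

definition WQSym :: "'k::field series set" where
  "WQSym = series.span (\<Union>n. WQSym_deg n)"

definition comp_equiv :: "nat \<Rightarrow> nat set list \<Rightarrow> nat set list \<Rightarrow> bool" where
  "comp_equiv n \<pi> \<tau> \<longleftrightarrow>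
     (\<forall>A \<in> nonempty_subsets n. card (first_part A \<pi>) = 1 \<longleftrightarrow> card (first_part A \<tau>) = 1)"

definition N_series :: "nat \<Rightarrow> nat set list \<Rightarrow> 'k::field series" where
  "N_series n \<pi> = (\<Sum>\<tau> \<in> {\<tau> \<in> set_compositions n. comp_equiv n \<pi> \<tau>}. M_series n \<tau>)"

definition SC :: "'k::field series set" where
  "SC = series.span {N_series n \<pi> | n \<pi>. \<pi> \<in> set_compositions n}"


section \<open>Relations\<close>

definition simple_relations :: "'k::field polytope_comb set" where
  "simple_relations =
     {polytope_basis n q1 - polytope_basis n q2 | n q1 q2.
        hypergraphic n q1 \<and> hypergraphic n q2 \<and> supp_family n q1 = supp_family n q2}"

definition Orth :: "nat \<Rightarrow> nat set \<Rightarrow> nat set list set" where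
  "Orth n A = {\<pi> \<in> set_compositions n. card (first_part A \<pi>) = 1}"

definition modular_relation ::
    "nat \<Rightarrow> nat set set \<Rightarrow> nat set set \<Rightarrow> 'k::field polytope_comb" where
  "modular_relation n \<A> \<B> =
     (\<Sum>\<T> \<in> Pow \<B>. free_scale ((- 1) ^ card \<T>)
        (polytope_basis n (family_polytope \<A> + family_polytope \<T>)))"

definition modular_relations :: "'k::field polytope_comb set" where
  "modular_relations =
     {modular_relation n \<A> \<B> | n \<A> \<B>.
        \<A> \<subseteq> nonempty_subsets n \<and> \<B> \<subseteq> nonempty_subsets n \<and> \<A> \<inter> \<B> = {} \<and>
        (\<Union>A\<in>\<A>. set_compositions n - Orth n A) \<union> (\<Union>B\<in>\<B>. Orth n B) = set_compositions n}"

end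

theory Submission
  imports Defs
begin

text \<open>
  The face of a Minkowski sum minimizing a functional is the sum of the minimizing faces of the
  summands. Hence \<open>f\<close> is generic for \<open>q\<close> iff \<open>f\<close> has a unique minimizer on every \<open>J\<close> in the
  support family of \<open>q\<close>, and modulo simple relations only the polytopes of families of subsets
  of \<open>[n]\<close> matter. Their Moebius transform in the lattice of families consists of the modular
  relations with \<open>\<B>\<close> the complement of \<open>\<A>\<close>, apart from the families \<open>\<A>\<close> of all sets orthogonal to
  some set composition \<open>\<pi>\<close>. For the latter, \<open>Upsilon\<close> takes the linearly independent values
  \<open>N_series n \<pi>\<close>, so it is injective on their span and its image is \<open>SC\<close>.
\<close>

section \<open>Minimal faces of Minkowski sums\<close>

definition weight :: "nat \<Rightarrow> (nat \<Rightarrow> nat) \<Rightarrow> (nat \<Rightarrow>\<^sub>0 real) \<Rightarrow> real" where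
  "weight n f x = (\<Sum>i\<in>{1..n}. real (f i) * Poly_Mapping.lookup x i)"

text \<open>Scaling is defined through the abstraction function, so the scaled coefficient function
  must first be seen to have finite support.\<close>

lemma lookup_scaleR:
  "Poly_Mapping.lookup (r *\<^sub>R x) i = r *\<^sub>R Poly_Mapping.lookup (x :: 'a \<Rightarrow>\<^sub>0 'b::real_vector) i"
proof -
  have "finite {i. r *\<^sub>R Poly_Mapping.lookup x i \<noteq> 0}"
    by (rule finite_subset[OF _ finite_lookup[of x]]) auto
  then show ?thesis
    by (simp add: scaleR_poly_mapping_def Abs_poly_mapping_inverse)
qed

lemma weight_zero [simp]: "weight n f 0 = 0"
  by (simp add: weight_def)

lemma weight_add: "weight n f (x + y) = weight n f x + weight n f y"
  by (simp add: weight_def lookup_add sum.distrib algebra_simps)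

lemma weight_scaleR: "weight n f (r *\<^sub>R x) = r * weight n f x"
  by (simp add: weight_def lookup_scaleR sum_distrib_left algebra_simps)

lemma weight_sum: "weight n f (sum x I) = (\<Sum>i\<in>I. weight n f (x i))"
  by (induction I rule: infinite_finite_induct) (auto simp: weight_add)

lemma linear_weight: "linear (weight n f)"
  by (rule linearI) (simp_all add: weight_add weight_scaleR)

lemma weight_single:
  assumes "j \<in> {1..n}"
  shows "weight n f (Poly_Mapping.single j 1) = f j"
proof -
  have "weight n f (Poly_Mapping.single j 1) = (\<Sum>i\<in>{1..n}. if j = i then real (f i) else 0)"
    unfolding weight_def by (intro sum.cong) (auto simp: lookup_single)
  then show ?thesis
    using assms by simp
qed

lemma min_face_weight: "min_face n f q = {x \<in> q. \<forall>y\<in>q. weight n f x \<le> weight n f y}"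
  by (simp add: min_face_def weight_def)

text \<open>Comparing \<open>a + b\<close> with the sum \<open>u + v\<close> of two minimizers
  forces each of \<open>a\<close> and \<open>b\<close> to attain its own minimum.\<close>

lemma min_face_plus:
  assumes "min_face n f A \<noteq> {}" "min_face n f B \<noteq> {}"
  shows "min_face n f (A + B) = min_face n f A + min_face n f B"
proof
  show "min_face n f A + min_face n f B \<subseteq> min_face n f (A + B)"
    by (auto simp: min_face_weight weight_add elim!: set_plus_elim intro!: add_mono)
next
  from assms obtain u v where u: "u \<in> min_face n f A" and v: "v \<in> min_face n f B"
    by blast
  show "min_face n f (A + B) \<subseteq> min_face n f A + min_face n f B"
  proof
    fix x assume x: "x \<in> min_face n f (A + B)"
    then obtain a b where ab: "x = a + b" "a \<in> A" "b \<in> B"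
      by (auto simp: min_face_weight elim!: set_plus_elim)
    have "u + v \<in> A + B"
      using u v by (auto simp: min_face_weight)
    with x have "weight n f a + weight n f b \<le> weight n f u + weight n f v"
      by (auto simp: min_face_weight weight_add ab)
    moreover have "weight n f u \<le> weight n f a" "weight n f v \<le> weight n f b"
      using u v ab by (auto simp: min_face_weight)
    ultimately have "weight n f a = weight n f u" "weight n f b = weight n f v"
      by linarith+
    then have "a \<in> min_face n f A" "b \<in> min_face n f B"
      using u v ab by (auto simp: min_face_weight)
    then show "x \<in> min_face n f A + min_face n f B"
      by (auto simp: ab)
  qed
qed

lemma set_sum_nonempty:
  fixes S :: "'i \<Rightarrow> 'a::comm_monoid_add set"
  assumes "\<And>i. i \<in> I \<Longrightarrow> S i \<noteq> {}"
  shows "sum S I \<noteq> {}"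
  using assms
proof (induction I rule: infinite_finite_induct)
  case (insert i I)
  then obtain x y where "x \<in> S i" "y \<in> sum S I"
    by blast
  then have "x + y \<in> S i + sum S I"
    by blast
  then show ?case
    using insert.hyps by auto
qed auto

lemma min_face_sum:
  assumes "finite I" "\<And>i. i \<in> I \<Longrightarrow> min_face n f (S i) \<noteq> {}"
  shows "min_face n f (sum S I) = (\<Sum>i\<in>I. min_face n f (S i))"
  using assms
proof (induction I)
  case empty
  then show ?case
    by (auto simp: min_face_weight)
next
  case (insert i I)
  have "(\<Sum>i\<in>I. min_face n f (S i)) \<noteq> {}"
    by (rule set_sum_nonempty) (use insert.prems in auto)
  then show ?case
    using insert by (simp add: min_face_plus)
qed

text \<open>By cancellation, translating \<open>A\<close> by a point of \<open>B\<close> embeds it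
  into \<open>A + B\<close>, and symmetrically for \<open>B\<close>.\<close>

lemma is_singleton_set_plus:
  fixes A B :: "'a::cancel_comm_monoid_add set"
  assumes "A \<noteq> {}" "B \<noteq> {}"
  shows "is_singleton (A + B) \<longleftrightarrow> is_singleton A \<and> is_singleton B"
proof
  assume "is_singleton (A + B)"
  then obtain z where z: "A + B = {z}"
    by (auto simp: is_singleton_def)
  obtain a b where ab: "a \<in> A" "b \<in> B"
    using assms by blast
  have sum_eq: "x + y = z" if "x \<in> A" "y \<in> B" for x y
    using set_plus_intro[OF that] z by simp
  have "x = a" if "x \<in> A" for x
  proof -
    have "x + b = a + b"
      using sum_eq that ab by simp
    then show ?thesis
      by simp
  qed
  then have "A = {a}"
    using ab by blast
  moreover have "y = b" if "y \<in> B" for y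
  proof -
    have "a + y = a + b"
      using sum_eq that ab by simp
    then show ?thesis
      by simp
  qed
  then have "B = {b}"
    using ab by blast
  ultimately show "is_singleton A \<and> is_singleton B"
    by simp
next
  assume "is_singleton A \<and> is_singleton B"
  then obtain a b where "A = {a}" "B = {b}"
    by (auto simp: is_singleton_def)
  then show "is_singleton (A + B)"
    by (auto simp: set_plus_image)
qed

lemma is_singleton_set_sum:
  fixes S :: "'i \<Rightarrow> 'a::cancel_comm_monoid_add set"
  assumes "finite I" "\<And>i. i \<in> I \<Longrightarrow> S i \<noteq> {}"
  shows "is_singleton (sum S I) \<longleftrightarrow> (\<forall>i\<in>I. is_singleton (S i))"
  using assms
proof (induction I)
  case empty
  then show ?case
    by simp
next
  case (insert i I)
  have "sum S I \<noteq> {}"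
    by (rule set_sum_nonempty) (use insert.prems in auto)
  then show ?case
    using insert by (simp add: is_singleton_set_plus)
qed

section \<open>Faces of simplices\<close>

text \<open>The combinatorial counterpart of \<open>min_face\<close>: these indices label the
  vertices of \<open>simplex_face J\<close> at which \<open>f\<close> is minimal.\<close>

definition argmins :: "(nat \<Rightarrow> nat) \<Rightarrow> nat set \<Rightarrow> nat set" where
  "argmins f J = {j \<in> J. f j = Min (f ` J)}"

lemma finite_nonempty_subsets: "finite (nonempty_subsets n)"
  by (simp add: nonempty_subsets_def)

lemma nonempty_subsetsD:
  assumes "J \<in> nonempty_subsets n"
  shows "finite J" "J \<noteq> {}" "J \<subseteq> {1..n}"
  using assms finite_subset by (auto simp: nonempty_subsets_def)

lemma argmins_nonempty:
  assumes "finite J" "J \<noteq> {}"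
  shows "argmins f J \<noteq> {}"
proof -
  have "Min (f ` J) \<in> f ` J"
    using assms by (intro Min_in) auto
  then show ?thesis
    by (auto simp: argmins_def)
qed

text \<open>The half-space on the right is convex and contains the vertices, hence their convex
  hull.\<close>

lemma weight_simplex_face_ge:
  assumes J: "J \<in> nonempty_subsets n" and x: "x \<in> simplex_face J"
  shows "real (Min (f ` J)) \<le> weight n f x"
proof -
  have "simplex_face J \<subseteq> {x. real (Min (f ` J)) \<le> weight n f x}"
    unfolding simplex_face_def
  proof (rule hull_minimal)
    show "(\<lambda>j. Poly_Mapping.single j 1) ` J \<subseteq> {x. real (Min (f ` J)) \<le> weight n f x}"
    proof (clarsimp)
      fix j assume j: "j \<in> J"
      then have "Min (f ` J) \<le> f j"
        using nonempty_subsetsD(1)[OF J] by simp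
      moreover have "j \<in> {1..n}"
        using nonempty_subsetsD(3)[OF J] j by blast
      ultimately show "real (Min (f ` J)) \<le> weight n f (Poly_Mapping.single j 1)"
        by (simp only: weight_single of_nat_le_iff)
    qed
  next
    show "convex {x. real (Min (f ` J)) \<le> weight n f x}"
      using convex_linear_vimage[OF linear_weight, of "{real (Min (f ` J))..}"]
      by (simp add: vimage_def)
  qed
  then show ?thesis
    using x by blast
qed

lemma min_face_simplex_face:
  assumes J: "J \<in> nonempty_subsets n"
  shows "min_face n f (simplex_face J) = {x \<in> simplex_face J. weight n f x = Min (f ` J)}"
proof -
  obtain j where j: "j \<in> argmins f J"
    using argmins_nonempty nonempty_subsetsD[OF J] by blast
  have "Poly_Mapping.single j 1 \<in> simplex_face J"
    unfolding simplex_face_def by (rule hull_inc) (use j in \<open>auto simp: argmins_def\<close>)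
  moreover have "weight n f (Poly_Mapping.single j 1) = Min (f ` J)"
    using j nonempty_subsetsD(3)[OF J] by (subst weight_single) (auto simp: argmins_def)
  ultimately show ?thesis
    using weight_simplex_face_ge[OF J, of _ f]
    by (fastforce simp: min_face_weight)
qed

lemma single_in_min_face:
  assumes J: "J \<in> nonempty_subsets n" and j: "j \<in> argmins f J"
  shows "Poly_Mapping.single j 1 \<in> min_face n f (simplex_face J)"
proof -
  have "Poly_Mapping.single j 1 \<in> simplex_face J"
    unfolding simplex_face_def by (rule hull_inc) (use j in \<open>auto simp: argmins_def\<close>)
  moreover have "weight n f (Poly_Mapping.single j 1) = Min (f ` J)"
    using j nonempty_subsetsD(3)[OF J] by (subst weight_single) (auto simp: argmins_def)
  ultimately show ?thesis
    using J by (simp add: min_face_simplex_face)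
qed

lemma min_face_simplex_face_nonempty:
  assumes "J \<in> nonempty_subsets n"
  shows "min_face n f (simplex_face J) \<noteq> {}"
  using single_in_min_face[OF assms] argmins_nonempty nonempty_subsetsD[OF assms] by blast

text \<open>
  If \<open>j\<close> is the only minimizer of \<open>f\<close> on \<open>J\<close>, then the vertex \<open>e\<^sub>j\<close> together with the open
  half-space of larger weight is convex, hence contains the simplex.
\<close>

lemma is_singleton_min_face_simplex_face:
  assumes J: "J \<in> nonempty_subsets n"
  shows "is_singleton (min_face n f (simplex_face J)) \<longleftrightarrow> card (argmins f J) = 1"
proof
  assume "is_singleton (min_face n f (simplex_face J))"
  then obtain x where x: "min_face n f (simplex_face J) = {x}"
    by (auto simp: is_singleton_def)
  obtain j where j: "j \<in> argmins f J"
    using argmins_nonempty nonempty_subsetsD[OF J] by blast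
  \<comment> \<open>Two minimizing indices give two vertices in a singleton, and a vertex determines
    its index.\<close>
  have "i = j" if "i \<in> argmins f J" for i
  proof -
    have "Poly_Mapping.single i (1::real) = Poly_Mapping.single j 1"
      using single_in_min_face[OF J that] single_in_min_face[OF J j] x by simp
    then show ?thesis
      by (metis lookup_single_eq lookup_single_not_eq zero_neq_one)
  qed
  with j have "argmins f J = {j}"
    by blast
  then show "card (argmins f J) = 1"
    by simp
next
  assume "card (argmins f J) = 1"
  then obtain j where j: "argmins f J = {j}"
    by (auto simp: card_1_singleton_iff)
  define s where "s = Poly_Mapping.single j (1::real)"
  define m where "m = real (Min (f ` J))"
  have s: "s \<in> min_face n f (simplex_face J)"
    unfolding s_def by (rule single_in_min_face[OF J]) (simp add: j)
  then have ws: "weight n f s = m"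
    using J by (simp add: min_face_simplex_face m_def)
  have "simplex_face J \<subseteq> {x. x = s \<or> m < weight n f x}"
    unfolding simplex_face_def
  proof (rule hull_minimal)
    show "(\<lambda>j. Poly_Mapping.single j 1) ` J \<subseteq> {x. x = s \<or> m < weight n f x}"
    proof (intro image_subsetI, clarify)
      fix i assume i: "i \<in> J" and nlt: "\<not> m < weight n f (Poly_Mapping.single i 1)"
      have "i \<in> {1..n}"
        using nonempty_subsetsD(3)[OF J] i by blast
      then have "f i \<le> Min (f ` J)"
        using nlt by (simp only: weight_single m_def of_nat_less_iff not_less)
      moreover have "Min (f ` J) \<le> f i"
        using nonempty_subsetsD(1)[OF J] i by simp
      ultimately have "i \<in> argmins f J"
        using i by (simp add: argmins_def)
      then show "Poly_Mapping.single i 1 = s"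
        using j by (simp add: s_def)
    qed
  next
    show "convex {x. x = s \<or> m < weight n f x}"
    proof (rule convexI)
      fix x y :: "nat \<Rightarrow>\<^sub>0 real" and u v :: real
      assume x: "x \<in> {x. x = s \<or> m < weight n f x}" and y: "y \<in> {x. x = s \<or> m < weight n f x}"
        and uv: "0 \<le> u" "0 \<le> v" "u + v = 1"
      show "u *\<^sub>R x + v *\<^sub>R y \<in> {x. x = s \<or> m < weight n f x}"
      \<comment> \<open>Outside these degenerate cases both coefficients are positive and at least
        one of the points has weight strictly above \<open>m\<close>.\<close>
      proof (cases "u = 0 \<or> v = 0 \<or> x = s \<and> y = s")
        case True
        then show ?thesis
          using x y uv by (auto simp: scaleR_left_distrib[symmetric])
      next
        case False
        then have u: "0 < u" "0 < v"
          using uv by auto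
        have "m \<le> weight n f x" "m \<le> weight n f y" "m < weight n f x \<or> m < weight n f y"
          using x y False ws by auto
        then have "u * m + v * m < u * weight n f x + v * weight n f y"
          using u by (auto intro: add_less_le_mono add_le_less_mono mult_left_mono mult_strict_left_mono)
        moreover have "u * m + v * m = m"
          using uv by (metis distrib_right mult_1)
        ultimately show ?thesis
          by (simp add: weight_add weight_scaleR)
      qed
    qed
  qed
  then have "x = s" if "x \<in> min_face n f (simplex_face J)" for x
    using that J by (auto simp: min_face_simplex_face m_def)
  with s have "min_face n f (simplex_face J) = {s}"
    by blast
  then show "is_singleton (min_face n f (simplex_face J))"
    by simp
qed

text \<open>For \<open>c = 0\<close> both sides collapse to the origin, since \<open>q\<close> and
  its minimal face are nonempty; for positive \<open>c\<close> the order of weights is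
  preserved.\<close>

lemma min_face_scaleR:
  assumes "0 \<le> c" "min_face n f q \<noteq> {}"
  shows "min_face n f ((*\<^sub>R) c ` q) = (*\<^sub>R) c ` min_face n f q"
proof (cases "c = 0")
  case True
  moreover have "q \<noteq> {}"
    using assms(2) by (auto simp: min_face_weight)
  ultimately show ?thesis
    using assms(2) by (auto simp: min_face_weight)
next
  case False
  then show ?thesis
    using assms(1) by (auto simp: min_face_weight weight_scaleR)
qed

lemma is_singleton_scaleR_image:
  fixes S :: "'a::real_vector set"
  assumes "S \<noteq> {}"
  shows "is_singleton ((*\<^sub>R) c ` S) \<longleftrightarrow> c = 0 \<or> is_singleton S"
proof (cases "c = 0")
  case True
  then show ?thesis
    using assms by (auto simp: is_singleton_def)
next
  case False
  then have "inj_on ((*\<^sub>R) c) S"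
    by (auto simp: inj_on_def)
  then show ?thesis
    using False by (simp add: is_singleton_altdef card_image)
qed

section \<open>Hypergraphic polytopes\<close>

lemma min_face_hypergraphic:
  assumes "hypergraphic_coeffs n q a"
  shows "min_face n f q = (\<Sum>J\<in>nonempty_subsets n. (*\<^sub>R) (a J) ` min_face n f (simplex_face J))"
proof -
  have "min_face n f q = (\<Sum>J\<in>nonempty_subsets n. min_face n f ((*\<^sub>R) (a J) ` simplex_face J))"
    using assms min_face_simplex_face_nonempty
    by (simp add: hypergraphic_coeffs_def min_face_sum finite_nonempty_subsets min_face_scaleR)
  also have "\<dots> = (\<Sum>J\<in>nonempty_subsets n. (*\<^sub>R) (a J) ` min_face n f (simplex_face J))"
    using assms min_face_simplex_face_nonempty
    by (intro sum.cong) (auto simp: hypergraphic_coeffs_def min_face_scaleR)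
  finally show ?thesis .
qed

text \<open>The minimal face is a Minkowski sum of scaled faces of simplices, so it is a point iff
  every summand is. A zero coefficient always gives a point.\<close>

lemma generic_hypergraphic_coeffs:
  assumes a: "hypergraphic_coeffs n q a"
  shows "generic n q f \<longleftrightarrow> (\<forall>J\<in>nonempty_subsets n. 0 < a J \<longrightarrow> card (argmins f J) = 1)"
proof -
  have "generic n q f \<longleftrightarrow>
      (\<forall>J\<in>nonempty_subsets n. is_singleton ((*\<^sub>R) (a J) ` min_face n f (simplex_face J)))"
    unfolding generic_def min_face_hypergraphic[OF a]
    by (intro is_singleton_set_sum) (auto simp: finite_nonempty_subsets min_face_simplex_face_nonempty)
  also have "\<dots> \<longleftrightarrow> (\<forall>J\<in>nonempty_subsets n. a J = 0 \<or> card (argmins f J) = 1)"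
    by (intro ball_cong)
      (auto simp: is_singleton_scaleR_image min_face_simplex_face_nonempty
        is_singleton_min_face_simplex_face)
  also have "\<dots> \<longleftrightarrow> (\<forall>J\<in>nonempty_subsets n. 0 < a J \<longrightarrow> card (argmins f J) = 1)"
    using a by (fastforce simp: hypergraphic_coeffs_def)
  finally show ?thesis .
qed

section \<open>Uniqueness of the coefficients\<close>

lemma min_face_hypergraphic_nonempty:
  assumes "hypergraphic_coeffs n q a"
  shows "min_face n f q \<noteq> {}"
  unfolding min_face_hypergraphic[OF assms]
  by (intro set_sum_nonempty) (auto simp: min_face_simplex_face_nonempty)

text \<open>Weight is additive and constant on the minimal face of each simplex. This expresses the
  minimum over \<open>q\<close> linearly in the coefficients.\<close>

lemma weight_min_face_hypergraphic:
  assumes a: "hypergraphic_coeffs n q a" and x: "x \<in> min_face n f q"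
  shows "weight n f x = (\<Sum>J\<in>nonempty_subsets n. a J * Min (f ` J))"
proof -
  obtain y where y: "x = sum y (nonempty_subsets n)"
    "\<And>J. J \<in> nonempty_subsets n \<Longrightarrow> y J \<in> (*\<^sub>R) (a J) ` min_face n f (simplex_face J)"
    using x unfolding min_face_hypergraphic[OF a] set_sum_alt[OF finite_nonempty_subsets] by blast
  show ?thesis
    unfolding y(1) weight_sum
  proof (rule sum.cong[OF refl])
    fix J assume J: "J \<in> nonempty_subsets n"
    then show "weight n f (y J) = a J * Min (f ` J)"
      using y(2)[OF J] by (auto simp: weight_scaleR min_face_simplex_face)
  qed
qed

lemma Min_indicator:
  assumes "finite J" "J \<noteq> {}"
  shows "Min ((\<lambda>i. of_bool (i \<in> K)) ` J) = (of_bool (J \<subseteq> K) :: nat)"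
proof (cases "J \<subseteq> K")
  case True
  then have "(\<lambda>i. of_bool (i \<in> K)) ` J = {1 :: nat}"
    using assms(2) by auto
  then show ?thesis
    using True by simp
next
  case False
  then obtain i where "i \<in> J" "i \<notin> K"
    by blast
  then have "0 \<in> (\<lambda>i. of_bool (i \<in> K) :: nat) ` J"
    by force
  then have "Min ((\<lambda>i. of_bool (i \<in> K)) ` J) \<le> (0 :: nat)"
    using assms(1) by (intro Min_le) auto
  then show ?thesis
    using False by simp
qed

text \<open>
  The minimal value of the indicator of \<open>K\<close> on the polytope is the sum of the coefficients of the
  subsets of \<open>K\<close>, so the coefficients are recovered by Moebius inversion.
\<close>

lemma sum_hypergraphic_coeffs:
  assumes a: "hypergraphic_coeffs n q a" and b: "hypergraphic_coeffs n q b"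
  shows "(\<Sum>J\<in>{J\<in>nonempty_subsets n. J \<subseteq> K}. a J) = (\<Sum>J\<in>{J\<in>nonempty_subsets n. J \<subseteq> K}. b J)"
proof -
  \<comment> \<open>The indicator takes the value 0 and so need not be a coloring;
    \<open>min_face\<close> accepts any function to the naturals.\<close>
  let ?f = "\<lambda>i. of_bool (i \<in> K) :: nat"
  obtain x where x: "x \<in> min_face n ?f q"
    using min_face_hypergraphic_nonempty[OF a] by blast
  have *: "weight n ?f x = (\<Sum>J\<in>{J\<in>nonempty_subsets n. J \<subseteq> K}. c J)"
    if c: "hypergraphic_coeffs n q c" for c
  proof -
    have "weight n ?f x = (\<Sum>J\<in>nonempty_subsets n. if J \<subseteq> K then c J else 0)"
      unfolding weight_min_face_hypergraphic[OF c x]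
    proof (rule sum.cong[OF refl])
      fix J assume "J \<in> nonempty_subsets n"
      then have "Min (?f ` J) = of_bool (J \<subseteq> K)"
        by (intro Min_indicator nonempty_subsetsD)
      then show "c J * real (Min (?f ` J)) = (if J \<subseteq> K then c J else 0)"
        by (simp only: of_nat_of_bool) simp
    qed
    then show ?thesis
      by (simp add: sum.inter_filter finite_nonempty_subsets)
  qed
  show ?thesis
    using *[OF a] *[OF b] by simp
qed

text \<open>Induction along proper inclusion: the sums over all subsets of \<open>K\<close> agree,
  and so do the terms of its proper subsets, which leaves the term of \<open>K\<close>
  itself.\<close>

lemma hypergraphic_coeffs_unique:
  assumes a: "hypergraphic_coeffs n q a" and b: "hypergraphic_coeffs n q b"
  shows "a = b"
proof
  fix K
  show "a K = b K"
  proof (cases "finite K")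
    case False
    then have "K \<notin> nonempty_subsets n"
      using nonempty_subsetsD(1) by blast
    then show ?thesis
      using a b by (simp add: hypergraphic_coeffs_def)
  next
    case True
    then show ?thesis
    proof (induction K rule: finite_psubset_induct)
      case (psubset K)
      show ?case
      proof (cases "K \<in> nonempty_subsets n")
        case False
        then show ?thesis
          using a b by (simp add: hypergraphic_coeffs_def)
      next
        case K: True
        let ?S = "{J\<in>nonempty_subsets n. J \<subset> K}"
        have S: "{J\<in>nonempty_subsets n. J \<subseteq> K} = insert K ?S"
          using K by auto
        have "finite ?S"
          by (simp add: finite_nonempty_subsets)
        then have "a K + sum a ?S = b K + sum b ?S"
          using sum_hypergraphic_coeffs[OF a b, of K] unfolding S by simp
        moreover have "sum a ?S = sum b ?S"
          using psubset.IH by (intro sum.cong) auto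
        ultimately show ?thesis
          by simp
      qed
    qed
  qed
qed

text \<open>Uniqueness replaces the \<open>THE\<close> in \<open>supp_family\<close> by any
  coefficient function at hand.\<close>

lemma supp_family_eq:
  assumes "hypergraphic_coeffs n q a"
  shows "supp_family n q = {J. 0 < a J}"
proof -
  have "(THE a. hypergraphic_coeffs n q a) = a"
    using assms hypergraphic_coeffs_unique by blast
  then show ?thesis
    by (simp add: supp_family_def)
qed

lemma supp_family_subset:
  assumes "hypergraphic n q"
  shows "supp_family n q \<subseteq> nonempty_subsets n"
  using assms by (fastforce simp: hypergraphic_def supp_family_eq hypergraphic_coeffs_def)

text \<open>Genericity sees only the signs of the coefficients, which is why simple relations lie in
  the kernel.\<close>

lemma generic_iff:
  assumes "hypergraphic n q"
  shows "generic n q f \<longleftrightarrow> (\<forall>J\<in>supp_family n q. card (argmins f J) = 1)"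
  using assms supp_family_subset[OF assms]
  by (auto simp: hypergraphic_def generic_hypergraphic_coeffs supp_family_eq)

section \<open>Polytopes of families\<close>

lemma hypergraphic_coeffs_family_polytope:
  assumes "\<A> \<subseteq> nonempty_subsets n"
  shows "hypergraphic_coeffs n (family_polytope \<A>) (\<lambda>J. if J \<in> \<A> then 1 else 0)"
proof -
  \<comment> \<open>Scaling a nonempty set by 0 gives the singleton of the origin, the neutral
    element of the Minkowski sum, and not the empty set.\<close>
  have "simplex_face J \<noteq> {}" if "J \<in> nonempty_subsets n" for J
    using nonempty_subsetsD[OF that] by (auto simp: simplex_face_def)
  then have "(\<Sum>J\<in>nonempty_subsets n. (*\<^sub>R) (if J \<in> \<A> then 1 else 0) ` simplex_face J)
      = (\<Sum>J\<in>nonempty_subsets n. if J \<in> \<A> then simplex_face J else 0)"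
    by (intro sum.cong) auto
  also have "\<dots> = (\<Sum>J\<in>{J\<in>nonempty_subsets n. J \<in> \<A>}. simplex_face J)"
    by (simp add: sum.inter_filter finite_nonempty_subsets)
  also have "{J\<in>nonempty_subsets n. J \<in> \<A>} = \<A>"
    using assms by blast
  finally show ?thesis
    using assms by (auto simp: hypergraphic_coeffs_def family_polytope_def)
qed

lemma
  assumes "\<A> \<subseteq> nonempty_subsets n"
  shows hypergraphic_family_polytope: "hypergraphic n (family_polytope \<A>)"
    and supp_family_family_polytope: "supp_family n (family_polytope \<A>) = \<A>"
  using hypergraphic_coeffs_family_polytope[OF assms]
  by (auto simp: hypergraphic_def supp_family_eq)

lemma family_polytope_Un:
  assumes "finite \<A>" "finite \<B>" "\<A> \<inter> \<B> = {}"
  shows "family_polytope \<A> + family_polytope \<B> = family_polytope (\<A> \<union> \<B>)"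
  using assms by (simp add: family_polytope_def sum.union_disjoint)

section \<open>Colorings and set compositions\<close>

lemma inj_on_word: "inj_on (word n) (colorings n)"
proof (rule inj_onI)
  fix f g assume f: "f \<in> colorings n" and g: "g \<in> colorings n" and eq: "word n f = word n g"
  show "f = g"
  proof (rule PiE_ext)
    show "f \<in> {1..n} \<rightarrow>\<^sub>E {1..}" "g \<in> {1..n} \<rightarrow>\<^sub>E {1..}"
      using f g by (auto simp: colorings_def)
    fix i assume "i \<in> {1..n}"
    then show "f i = g i"
      using eq by (auto simp: word_def)
  qed
qed

lemma length_word [simp]: "length (word n f) = n"
  by (simp add: word_def)

text \<open>The length of a word determines the degree, and injectivity of \<open>word n\<close>
  leaves at most one coloring to count.\<close>

lemma monomial_sum_word:
  assumes "S \<subseteq> colorings n" "f \<in> colorings m"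
  shows "monomial_sum n S (word m f) = of_bool (m = n \<and> f \<in> S)"
proof -
  have "{g \<in> S. word n g = word m f} = (if m = n \<and> f \<in> S then {f} else {})"
  proof (cases "m = n")
    case True
    then have "word n g = word m f \<longleftrightarrow> g = f" if "g \<in> S" for g
      using that assms by (auto simp: inj_on_eq_iff[OF inj_on_word])
    then show ?thesis
      using True by auto
  next
    case False
    then show ?thesis
      by (auto dest: arg_cong[of _ _ length])
  qed
  then show ?thesis
    by (simp add: monomial_sum_def)
qed

lemma monomial_sum_nonword:
  assumes "S \<subseteq> colorings n" "w \<notin> word n ` colorings n"
  shows "monomial_sum n S w = 0"
proof -
  have "{f \<in> S. word n f = w} = {}"
    using assms by auto
  then show ?thesis
    by (simp only: monomial_sum_def card.empty of_nat_0)
qed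

lemma first_part_comp_of:
  assumes A: "A \<in> nonempty_subsets n"
  shows "first_part A (comp_of n f) = argmins f A"
proof -
  note A = nonempty_subsetsD[OF A]
  define vs where "vs = sorted_list_of_set (f ` {1..n})"
  have sorted: "sorted_wrt (<) vs" and set_vs: "set vs = f ` {1..n}"
    by (simp_all add: vs_def)
  have block: "A \<inter> comp_of n f ! i = {j \<in> A. f j = vs ! i}" if "i < length vs" for i
    using A that by (auto simp: comp_of_def vs_def)
  have len: "length (comp_of n f) = length vs"
    by (simp add: comp_of_def vs_def)
  have "Min (f ` A) \<in> f ` A"
    using A by (intro Min_in) auto
  then obtain k where k: "k < length vs" "vs ! k = Min (f ` A)"
    using A(3) set_vs by (metis image_mono in_set_conv_nth subsetD)
  have "(LEAST i. i < length (comp_of n f) \<and> A \<inter> comp_of n f ! i \<noteq> {}) = k"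
  proof (rule Least_equality)
    show "k < length (comp_of n f) \<and> A \<inter> comp_of n f ! k \<noteq> {}"
      using k \<open>Min (f ` A) \<in> f ` A\<close> by (auto simp: len block)
  next
    fix i assume i: "i < length (comp_of n f) \<and> A \<inter> comp_of n f ! i \<noteq> {}"
    show "k \<le> i"
    proof (rule ccontr)
      assume "\<not> k \<le> i"
      then have "vs ! i < Min (f ` A)"
        using sorted_wrt_nth_less[OF sorted, of i k] k by simp
      moreover obtain j where "j \<in> A" "f j = vs ! i"
        using i block[of i] by (auto simp only: len)
      moreover have "Min (f ` A) \<le> f j"
        using A(1) \<open>j \<in> A\<close> by simp
      ultimately show False
        by simp
    qed
  qed
  then show ?thesis
    using k by (simp add: first_part_def block argmins_def)
qed

lemma comp_of_in_set_compositions: "comp_of n f \<in> set_compositions n"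
proof -
  let ?vs = "sorted_list_of_set (f ` {1..n})"
  have "sorted_wrt (\<lambda>u v. disjnt {i \<in> {1..n}. f i = u} {i \<in> {1..n}. f i = v}) ?vs"
    by (rule sorted_wrt_mono_rel[OF _ strict_sorted_list_of_set]) (auto simp: disjnt_def)
  then show ?thesis
    by (auto simp: set_compositions_def comp_of_def sorted_wrt_map)
qed

text \<open>Each element is colored by the position of its block.\<close>

lemma comp_of_surj:
  assumes "\<pi> \<in> set_compositions n"
  obtains f where "f \<in> colorings n" "comp_of n f = \<pi>"
proof -
  have ne: "{} \<notin> set \<pi>" and disj: "sorted_wrt disjnt \<pi>" and un: "\<Union>(set \<pi>) = {1..n}"
    using assms by (auto simp: set_compositions_def)
  have uniq: "k = l" if "k < length \<pi>" "l < length \<pi>" "i \<in> \<pi> ! k" "i \<in> \<pi> ! l" for i k l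
    using that sorted_wrt_nth_less[OF disj, of k l] sorted_wrt_nth_less[OF disj, of l k]
    by (cases k l rule: linorder_cases) (auto simp: disjnt_def)
  \<comment> \<open>List positions start at 0 and colors at 1, hence the \<open>Suc\<close>.\<close>
  define f where "f = (\<lambda>i\<in>{1..n}. Suc (THE k. k < length \<pi> \<and> i \<in> \<pi> ! k))"
  have f: "f i = Suc k" if "k < length \<pi>" "i \<in> \<pi> ! k" for i k
  proof -
    have "i \<in> {1..n}"
      using that un by (metis UnionI nth_mem)
    moreover have "(THE k. k < length \<pi> \<and> i \<in> \<pi> ! k) = k"
      using that uniq by blast
    ultimately show ?thesis
      by (simp add: f_def)
  qed
  have ex: "\<exists>k<length \<pi>. i \<in> \<pi> ! k" if "i \<in> {1..n}" for i
    using that un by (metis UnionE in_set_conv_nth)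
  have "f \<in> colorings n"
    by (auto simp: colorings_def f_def)
  moreover have "comp_of n f = \<pi>"
  proof -
    \<comment> \<open>Blocks are nonempty, so no value is skipped and entry \<open>k\<close> of
      \<open>comp_of n f\<close> is the fibre of \<open>Suc k\<close>.\<close>
    have "f ` {1..n} = {1..<Suc (length \<pi>)}"
    proof
      show "f ` {1..n} \<subseteq> {1..<Suc (length \<pi>)}"
        using ex f by fastforce
      show "{1..<Suc (length \<pi>)} \<subseteq> f ` {1..n}"
      proof
        fix v assume v: "v \<in> {1..<Suc (length \<pi>)}"
        then have lt: "v - 1 < length \<pi>"
          by auto
        then have "\<pi> ! (v - 1) \<noteq> {}"
          using ne by (metis nth_mem)
        then obtain i where i: "i \<in> \<pi> ! (v - 1)"
          by blast
        then have "i \<in> {1..n}"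
          using lt un by (metis UnionI nth_mem)
        moreover have "f i = v"
          using f[OF lt i] v by simp
        ultimately show "v \<in> f ` {1..n}"
          by blast
      qed
    qed
    then have vs: "sorted_list_of_set (f ` {1..n}) = [1..<Suc (length \<pi>)]"
      by (simp only: sorted_list_of_set_range)
    show ?thesis
    proof (rule nth_equalityI)
      show "length (comp_of n f) = length \<pi>"
        unfolding comp_of_def vs by (simp del: upt_Suc)
      fix k assume "k < length (comp_of n f)"
      then have k: "k < length \<pi>"
        unfolding comp_of_def vs by (simp del: upt_Suc)
      have "comp_of n f ! k = {i \<in> {1..n}. f i = Suc k}"
        unfolding comp_of_def vs using k by (simp del: upt_Suc)
      also have "\<dots> = \<pi> ! k"
      proof (intro set_eqI iffI)
        fix i assume "i \<in> {i \<in> {1..n}. f i = Suc k}"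
        then show "i \<in> \<pi> ! k"
          using ex f by fastforce
      next
        fix i assume "i \<in> \<pi> ! k"
        then show "i \<in> {i \<in> {1..n}. f i = Suc k}"
          using k f un by (auto dest: nth_mem)
      qed
      finally show "comp_of n f ! k = \<pi> ! k" .
    qed
  qed
  ultimately show ?thesis
    using that by blast
qed

text \<open>Nonempty disjoint blocks are distinct, and a finite set carries only finitely many
  distinct lists.\<close>

lemma finite_set_compositions: "finite (set_compositions n)"
proof (rule finite_subset)
  show "set_compositions n \<subseteq> {\<pi>. set \<pi> \<subseteq> Pow {1..n} \<and> distinct \<pi>}"
  proof (rule subsetI, rule CollectI, rule conjI)
    fix \<pi> assume "\<pi> \<in> set_compositions n"
    then have \<pi>: "{} \<notin> set \<pi>" "sorted_wrt disjnt \<pi>" "\<Union>(set \<pi>) = {1..n}"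
      by (auto simp: set_compositions_def)
    from \<pi> show "set \<pi> \<subseteq> Pow {1..n}"
      by blast
    from \<pi>(1,2) show "distinct \<pi>"
      by (induction \<pi>) (auto simp: disjnt_def)
  qed
qed (simp add: finite_subset_distinct)

text \<open>The transpose of \<open>Orth\<close>: the composition is fixed and the sets vary. Its
  fibres are the classes of \<open>comp_equiv\<close>.\<close>

definition orth_sets :: "nat \<Rightarrow> nat set list \<Rightarrow> nat set set" where
  "orth_sets n \<pi> = {A \<in> nonempty_subsets n. card (first_part A \<pi>) = 1}"

lemma orth_sets_subset: "orth_sets n \<pi> \<subseteq> nonempty_subsets n"
  by (auto simp: orth_sets_def)

lemma comp_equiv_iff: "comp_equiv n \<pi> \<tau> \<longleftrightarrow> orth_sets n \<pi> = orth_sets n \<tau>"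
  by (auto simp: comp_equiv_def orth_sets_def)

lemma Orth_eq: "A \<in> nonempty_subsets n \<Longrightarrow> Orth n A = {\<pi> \<in> set_compositions n. A \<in> orth_sets n \<pi>}"
  by (auto simp: Orth_def orth_sets_def)

section \<open>Coefficients of the series\<close>

lemma M_series_word:
  assumes "f \<in> colorings m"
  shows "M_series n \<pi> (word m f) = of_bool (m = n \<and> comp_of n f = \<pi>)"
  unfolding M_series_def using assms by (subst monomial_sum_word) auto

lemma sum_fun_apply: "(\<Sum>i\<in>I. F i) x = (\<Sum>i\<in>I. F i x)"
  by (induction I rule: infinite_finite_induct) auto

text \<open>Only the summand of the composition \<open>comp_of n f\<close> can contribute to this
  coefficient.\<close>

lemma N_series_word:
  assumes "f \<in> colorings m"
  shows "N_series n \<pi> (word m f) = of_bool (m = n \<and> orth_sets n (comp_of n f) = orth_sets n \<pi>)"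
proof -
  let ?C = "{\<tau> \<in> set_compositions n. comp_equiv n \<pi> \<tau>}"
  have "N_series n \<pi> (word m f) = (\<Sum>\<tau>\<in>?C. if comp_of n f = \<tau> then of_bool (m = n) else 0)"
    unfolding N_series_def sum_fun_apply
    by (intro sum.cong) (auto simp: M_series_word[OF assms])
  also have "\<dots> = of_bool (m = n \<and> comp_of n f \<in> ?C)"
    using finite_set_compositions by simp
  finally show ?thesis
    using comp_of_in_set_compositions by (auto simp: comp_equiv_iff)
qed

lemma N_series_nonword:
  assumes "w \<notin> word n ` colorings n"
  shows "N_series n \<pi> w = 0"
  unfolding N_series_def sum_fun_apply M_series_def
  using assms by (intro sum.neutral) (auto intro!: monomial_sum_nonword)

text \<open>Genericity becomes an inclusion of families, so the rest of the kernel argument is about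
  the lattice of families.\<close>

lemma chromatic_series_word:
  assumes q: "hypergraphic n q" and f: "f \<in> colorings m"
  shows "chromatic_series n q (word m f)
    = of_bool (m = n \<and> supp_family n q \<subseteq> orth_sets n (comp_of n f))"
proof -
  have "generic n q f \<longleftrightarrow> supp_family n q \<subseteq> orth_sets n (comp_of n f)"
    using supp_family_subset[OF q]
    by (auto simp: generic_iff[OF q] orth_sets_def first_part_comp_of)
  then show ?thesis
    unfolding chromatic_series_def using f by (subst monomial_sum_word) auto
qed

lemma chromatic_series_nonword:
  assumes "w \<notin> word n ` colorings n"
  shows "chromatic_series n q w = 0"
  unfolding chromatic_series_def using assms by (intro monomial_sum_nonword) auto

lemma series_eqI:
  assumes "\<And>f. f \<in> colorings n \<Longrightarrow> F (word n f) = G (word n f)"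
    and "\<And>w. w \<notin> word n ` colorings n \<Longrightarrow> F w = 0 \<and> G w = 0"
  shows "F = G"
  using assms by (metis ext imageE)

lemma chromatic_series_cong:
  assumes "hypergraphic n q1" "hypergraphic n q2" "supp_family n q1 = supp_family n q2"
  shows "chromatic_series n q1 = (chromatic_series n q2 :: 'k::field series)"
  using assms by (intro series_eqI[of n]) (auto simp: chromatic_series_word chromatic_series_nonword)

section \<open>The image of a modular relation\<close>

text \<open>Inclusion-exclusion: expand the product of \<open>1 - of_bool (x \<in> G)\<close> over
  \<open>x \<in> \<B>\<close>.\<close>

lemma alternating_sum_Pow:
  assumes "finite \<B>"
  shows "(\<Sum>\<T>\<in>Pow \<B>. (- 1) ^ card \<T> * of_bool (\<T> \<subseteq> G)) = (of_bool (\<B> \<inter> G = {}) :: 'k::comm_ring_1)"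
proof -
  have eq: "(\<Prod>x\<in>\<T>. of_bool (x \<in> G)) = (of_bool (\<T> \<subseteq> G) :: 'k)" if "\<T> \<subseteq> \<B>" for \<T>
    using finite_subset[OF that assms] by (induction rule: finite_induct) auto
  have "(of_bool (\<B> \<inter> G = {}) :: 'k) = (\<Prod>x\<in>\<B>. 1 - of_bool (x \<in> G))"
    using assms
  proof induction
    case (insert x F)
    then show ?case
      by (cases "x \<in> G") simp_all
  qed simp
  also have "\<dots> = (\<Sum>\<T>\<in>Pow \<B>. (- 1) ^ card \<T> * of_bool (\<T> \<subseteq> G))"
    unfolding prod_diff_conv_sum[OF assms] by (intro sum.cong) (auto simp: eq)
  finally show ?thesis ..
qed

interpretation Upsilon: Vector_Spaces.linear free_scale series_scale Upsilon
  by (rule linear_Upsilon)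

text \<open>Disjointness of \<open>\<A>\<close> and \<open>\<B>\<close> keeps every simplex at
  multiplicity one in the Minkowski sum.\<close>

lemma modular_relation_eq:
  assumes "\<A> \<subseteq> nonempty_subsets n" "\<B> \<subseteq> nonempty_subsets n" "\<A> \<inter> \<B> = {}"
  shows "modular_relation n \<A> \<B> =
    (\<Sum>\<T>\<in>Pow \<B>. free_scale ((- 1) ^ card \<T>) (polytope_basis n (family_polytope (\<A> \<union> \<T>))))"
  unfolding modular_relation_def
proof (rule sum.cong[OF refl])
  fix \<T> assume "\<T> \<in> Pow \<B>"
  then have "family_polytope \<A> + family_polytope \<T> = family_polytope (\<A> \<union> \<T>)"
    using assms finite_subset[OF _ finite_nonempty_subsets, of _ n]
    by (intro family_polytope_Un) blast+
  then show "free_scale ((- 1) ^ card \<T>) (polytope_basis n (family_polytope \<A> + family_polytope \<T>))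
      = free_scale ((- 1) ^ card \<T>) (polytope_basis n (family_polytope (\<A> \<union> \<T>)))"
    by simp
qed

lemma Upsilon_modular_relation:
  assumes "\<A> \<subseteq> nonempty_subsets n" "\<B> \<subseteq> nonempty_subsets n" "\<A> \<inter> \<B> = {}"
  shows "Upsilon (modular_relation n \<A> \<B>) w =
    (\<Sum>\<T>\<in>Pow \<B>. (- 1) ^ card \<T> * chromatic_series n (family_polytope (\<A> \<union> \<T>)) w)"
  by (simp add: modular_relation_eq[OF assms] Upsilon.sum Upsilon.scale Upsilon_basis
      sum_fun_apply series_scale_def)

text \<open>The condition on \<open>\<A>\<close> factors out of the sum over \<open>\<T>\<close>,
  and inclusion-exclusion evaluates the rest. The covering condition of
  \<open>modular_relations\<close> says that no composition passes the resulting test.\<close>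

lemma Upsilon_modular_relation_word:
  assumes "\<A> \<subseteq> nonempty_subsets n" "\<B> \<subseteq> nonempty_subsets n" "\<A> \<inter> \<B> = {}"
    and f: "f \<in> colorings m"
  shows "Upsilon (modular_relation n \<A> \<B>) (word m f) =
    of_bool (m = n \<and> \<A> \<subseteq> orth_sets n (comp_of n f) \<and> \<B> \<inter> orth_sets n (comp_of n f) = {})"
proof -
  let ?G = "orth_sets n (comp_of n f)"
  have fin: "finite \<B>"
    using assms(2) finite_nonempty_subsets finite_subset by blast
  have "Upsilon (modular_relation n \<A> \<B>) (word m f) =
    (\<Sum>\<T>\<in>Pow \<B>. of_bool (m = n \<and> \<A> \<subseteq> ?G) * ((- 1) ^ card \<T> * of_bool (\<T> \<subseteq> ?G)))"
    unfolding Upsilon_modular_relation[OF assms(1-3)]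
  proof (rule sum.cong[OF refl])
    fix \<T> assume "\<T> \<in> Pow \<B>"
    then have sub: "\<A> \<union> \<T> \<subseteq> nonempty_subsets n"
      using assms by blast
    show "(- 1) ^ card \<T> * chromatic_series n (family_polytope (\<A> \<union> \<T>)) (word m f) =
        of_bool (m = n \<and> \<A> \<subseteq> ?G) * ((- 1) ^ card \<T> * of_bool (\<T> \<subseteq> ?G))"
      by (simp add: chromatic_series_word[OF hypergraphic_family_polytope[OF sub] f]
          supp_family_family_polytope[OF sub])
  qed
  also have "\<dots> = of_bool (m = n \<and> \<A> \<subseteq> ?G) * of_bool (\<B> \<inter> ?G = {})"
    by (simp only: sum_distrib_left[symmetric] alternating_sum_Pow[OF fin])
  finally show ?thesis
    by (simp only: of_bool_conj mult.assoc)
qed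

lemma Upsilon_modular_relation_nonword:
  assumes "\<A> \<subseteq> nonempty_subsets n" "\<B> \<subseteq> nonempty_subsets n" "\<A> \<inter> \<B> = {}"
    and "w \<notin> word n ` colorings n"
  shows "Upsilon (modular_relation n \<A> \<B>) w = 0"
  by (simp add: Upsilon_modular_relation[OF assms(1-3)] chromatic_series_nonword[OF assms(4)])

text \<open>
  The Moebius transform of the basis elements of the polytopes \<open>family_polytope \<A>\<close>.
\<close>

definition full_modular :: "nat \<Rightarrow> nat set set \<Rightarrow> 'k::field polytope_comb" where
  "full_modular n \<A> = modular_relation n \<A> (nonempty_subsets n - \<A>)"

text \<open>With \<open>\<B>\<close> the complement of \<open>\<A>\<close>, containing
  \<open>\<A>\<close> and missing \<open>\<B>\<close> determine the family exactly.\<close>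

lemma Upsilon_full_modular_word:
  assumes "\<A> \<subseteq> nonempty_subsets n" "f \<in> colorings m"
  shows "Upsilon (full_modular n \<A>) (word m f) = of_bool (m = n \<and> orth_sets n (comp_of n f) = \<A>)"
  unfolding full_modular_def using assms orth_sets_subset[of n "comp_of n f"]
  by (subst Upsilon_modular_relation_word) auto

text \<open>Both series have coefficient 1 exactly at the words whose composition is equivalent to
  \<open>\<pi>\<close>. This gives explicit preimages for the generators of
  \<open>SC\<close>.\<close>

lemma Upsilon_full_modular_orth_sets:
  "Upsilon (full_modular n (orth_sets n \<pi>)) = (N_series n \<pi> :: 'k::field series)"
proof (rule series_eqI[of n])
  fix f assume "f \<in> colorings n"
  then show "Upsilon (full_modular n (orth_sets n \<pi>)) (word n f) = (N_series n \<pi> (word n f) :: 'k)"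
    by (simp add: Upsilon_full_modular_word N_series_word orth_sets_subset)
next
  fix w assume w: "w \<notin> word n ` colorings n"
  have "Upsilon (full_modular n (orth_sets n \<pi>)) w = (0 :: 'k)"
    unfolding full_modular_def
    by (rule Upsilon_modular_relation_nonword[OF _ _ _ w]) (use orth_sets_subset in auto)
  then show "Upsilon (full_modular n (orth_sets n \<pi>)) w = (0 :: 'k) \<and> N_series n \<pi> w = (0 :: 'k)"
    by (simp add: N_series_nonword[OF w])
qed

section \<open>The kernel\<close>

lemma subspace_HGP: "free.subspace (HGP :: 'k::field polytope_comb set)"
proof (rule free.subspaceI)
  fix v w :: "'k polytope_comb" assume "v \<in> HGP" "w \<in> HGP"
  then show "v + w \<in> HGP"
    using Poly_Mapping.keys_add[of v w] by (auto simp: HGP_def)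
next
  fix c and v :: "'k polytope_comb" assume "v \<in> HGP"
  moreover have "Poly_Mapping.keys (free_scale c v) \<subseteq> Poly_Mapping.keys v"
    by (auto simp: in_keys_iff lookup_free_scale)
  ultimately show "free_scale c v \<in> HGP"
    by (auto simp: HGP_def)
qed (simp add: HGP_def)

lemma polytope_basis_in_HGP: "hypergraphic n q \<Longrightarrow> polytope_basis n q \<in> HGP"
  by (simp add: HGP_def polytope_basis_def)

lemma HGP_eq_span: "HGP = free.span {polytope_basis n q | n q. hypergraphic n q}"
proof
  show "free.span {polytope_basis n q | n q. hypergraphic n q} \<subseteq> HGP"
    by (rule free.span_minimal[OF _ subspace_HGP]) (auto intro: polytope_basis_in_HGP)
next
  show "(HGP :: 'k::field polytope_comb set) \<subseteq> free.span {polytope_basis n q | n q. hypergraphic n q}"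
  proof
    fix v :: "'k polytope_comb" assume v: "v \<in> HGP"
    have "v = (\<Sum>x\<in>Poly_Mapping.keys v.
        free_scale (Poly_Mapping.lookup v x) (Poly_Mapping.single x 1))"
    proof (rule poly_mapping_eqI)
      fix y
      have "(\<Sum>x\<in>Poly_Mapping.keys v. Poly_Mapping.lookup v x * (1 when x = y))
          = (\<Sum>x\<in>Poly_Mapping.keys v. if x = y then Poly_Mapping.lookup v x else 0)"
        by (intro sum.cong) auto
      also have "\<dots> = Poly_Mapping.lookup v y"
        by (auto simp: in_keys_iff)
      finally show "Poly_Mapping.lookup v y = Poly_Mapping.lookup (\<Sum>x\<in>Poly_Mapping.keys v.
          free_scale (Poly_Mapping.lookup v x) (Poly_Mapping.single x 1)) y"
        by (simp add: lookup_sum lookup_free_scale lookup_single)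
    qed
    also have "\<dots> \<in> free.span {polytope_basis n q | n q. hypergraphic n q}"
    proof (intro free.span_sum free.span_scale free.span_base)
      fix x assume "x \<in> Poly_Mapping.keys v"
      moreover obtain n q where "x = (n, q)"
        by force
      ultimately show "Poly_Mapping.single x 1 \<in> {polytope_basis n q | n q. hypergraphic n q}"
        using v unfolding HGP_def polytope_basis_def by blast
    qed
    finally show "v \<in> free.span {polytope_basis n q | n q. hypergraphic n q}" .
  qed
qed

text \<open>The transform is unitriangular: besides the polytope of \<open>\<A>\<close>, it involves
  only strictly larger families. Hence the induction on the size of the complement.\<close>

lemma family_polytope_in_span_full_modular:
  assumes "\<A> \<subseteq> nonempty_subsets n"
  shows "polytope_basis n (family_polytope \<A>)
    \<in> free.span (full_modular n ` Pow (nonempty_subsets n) :: 'k::field polytope_comb set)"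
  using assms
proof (induction "card (nonempty_subsets n - \<A>)" arbitrary: \<A> rule: less_induct)
  case less
  let ?V = "free.span (full_modular n ` Pow (nonempty_subsets n) :: 'k polytope_comb set)"
  let ?B = "nonempty_subsets n - \<A>"
  let ?F = "\<lambda>\<T>. free_scale ((- 1) ^ card \<T>)
    (polytope_basis n (family_polytope (\<A> \<union> \<T>))) :: 'k polytope_comb"
  have fin: "finite (Pow ?B)"
    by (simp add: finite_nonempty_subsets)
  have "full_modular n \<A> = (\<Sum>\<T>\<in>Pow ?B. ?F \<T>)"
    unfolding full_modular_def using less.prems by (intro modular_relation_eq) auto
  also have "\<dots> = ?F {} + (\<Sum>\<T>\<in>Pow ?B - {{}}. ?F \<T>)"
    by (rule sum.remove[OF fin]) simp
  finally have "polytope_basis n (family_polytope \<A>)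
      = full_modular n \<A> - (\<Sum>\<T>\<in>Pow ?B - {{}}. ?F \<T>)"
    by simp
  also have "\<dots> \<in> ?V"
  proof (intro free.span_diff free.span_sum free.span_scale)
    show "full_modular n \<A> \<in> ?V"
      using less.prems by (intro free.span_base) auto
    fix \<T> assume \<T>: "\<T> \<in> Pow ?B - {{}}"
    then have "nonempty_subsets n - (\<A> \<union> \<T>) \<subset> ?B"
      by blast
    then have "card (nonempty_subsets n - (\<A> \<union> \<T>)) < card ?B"
      by (intro psubset_card_mono) (auto simp: finite_nonempty_subsets)
    then show "polytope_basis n (family_polytope (\<A> \<union> \<T>)) \<in> ?V"
      using less.hyps[of "\<A> \<union> \<T>"] less.prems \<T> by blast
  qed
  finally show ?case .
qed

text \<open>Simple relations vanish because the chromatic series depends only on the support family,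
  modular ones because the covering condition makes every coefficient zero.\<close>

lemma relations_in_kernel:
  assumes "v \<in> simple_relations \<union> modular_relations"
  shows "v \<in> HGP \<and> Upsilon v = (0 :: 'k::field series)"
  using assms
proof
  assume "v \<in> simple_relations"
  then obtain n q1 q2 where v: "v = polytope_basis n q1 - polytope_basis n q2"
    and q: "hypergraphic n q1" "hypergraphic n q2" "supp_family n q1 = supp_family n q2"
    by (auto simp: simple_relations_def)
  have "Upsilon v = 0"
    by (simp add: v Upsilon.diff Upsilon_basis chromatic_series_cong[OF q])
  then show ?thesis
    using q by (auto simp: v intro!: free.subspace_diff[OF subspace_HGP] polytope_basis_in_HGP)
next
  assume "v \<in> modular_relations"
  then obtain n \<A> \<B> where v: "v = modular_relation n \<A> \<B>"
    and sub: "\<A> \<subseteq> nonempty_subsets n" "\<B> \<subseteq> nonempty_subsets n" "\<A> \<inter> \<B> = {}"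
    and cover: "(\<Union>A\<in>\<A>. set_compositions n - Orth n A) \<union> (\<Union>B\<in>\<B>. Orth n B) = set_compositions n"
    by (auto simp: modular_relations_def)
  have "v \<in> HGP"
    unfolding v modular_relation_eq[OF sub]
    by (intro free.subspace_sum[OF subspace_HGP] free.subspace_scale[OF subspace_HGP]
        polytope_basis_in_HGP hypergraphic_family_polytope) (use sub in auto)
  moreover have "Upsilon v = 0"
  proof (rule series_eqI[of n])
    fix f assume f: "f \<in> colorings n"
    have "comp_of n f \<in> (\<Union>A\<in>\<A>. set_compositions n - Orth n A) \<union> (\<Union>B\<in>\<B>. Orth n B)"
      unfolding cover by (rule comp_of_in_set_compositions)
    then have "\<not> (\<A> \<subseteq> orth_sets n (comp_of n f) \<and> \<B> \<inter> orth_sets n (comp_of n f) = {})"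
      using sub comp_of_in_set_compositions by (auto simp: Orth_eq subset_iff)
    then show "Upsilon v (word n f) = 0 (word n f)"
      by (auto simp: v Upsilon_modular_relation_word[OF sub f])
  qed (simp add: v Upsilon_modular_relation_nonword[OF sub])
  ultimately show ?thesis
    by blast
qed

text \<open>These elements span a complement of the kernel in \<open>HGP\<close>. Equivalent
  compositions yield the same element.\<close>

definition realized_modulars :: "'k::field polytope_comb set" where
  "realized_modulars = {full_modular n (orth_sets n \<pi>) | n \<pi>. \<pi> \<in> set_compositions n}"

text \<open>If no composition realizes \<open>\<A>\<close>, each one either fails to be orthogonal
  to a member of \<open>\<A>\<close> or is orthogonal to a set outside it. This is the covering
  condition.\<close>

lemma full_modular_cases:
  assumes A: "\<A> \<subseteq> nonempty_subsets n"
  shows "full_modular n \<A> \<in> realized_modulars \<union> modular_relations"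
proof (cases "\<exists>\<pi>\<in>set_compositions n. orth_sets n \<pi> = \<A>")
  case True
  then show ?thesis
    by (auto simp: realized_modulars_def)
next
  case False
  let ?B = "nonempty_subsets n - \<A>"
  have "(\<Union>A\<in>\<A>. set_compositions n - Orth n A) \<union> (\<Union>B\<in>?B. Orth n B) = set_compositions n"
  proof
    show "set_compositions n \<subseteq> (\<Union>A\<in>\<A>. set_compositions n - Orth n A) \<union> (\<Union>B\<in>?B. Orth n B)"
    proof
      fix \<pi> assume \<pi>: "\<pi> \<in> set_compositions n"
      then have "orth_sets n \<pi> \<noteq> \<A>"
        using False by blast
      then show "\<pi> \<in> (\<Union>A\<in>\<A>. set_compositions n - Orth n A) \<union> (\<Union>B\<in>?B. Orth n B)"
        using A \<pi> orth_sets_subset[of n \<pi>] by (auto simp: Orth_eq subset_iff)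
    qed
  qed (auto simp: Orth_def)
  then show ?thesis
    using A unfolding modular_relations_def full_modular_def by blast
qed

text \<open>A polytope differs from the one of its support family by a simple relation, and the
  latter is a combination of transforms, each realized or a modular relation.\<close>

lemma HGP_eq_span_relations:
  "(HGP :: 'k::field polytope_comb set) =
    free.span ((simple_relations \<union> modular_relations) \<union> realized_modulars)"
proof
  let ?V = "free.span ((simple_relations \<union> modular_relations) \<union> realized_modulars)
    :: 'k polytope_comb set"
  have "full_modular n ` Pow (nonempty_subsets n) \<subseteq> ?V" for n
    using full_modular_cases by (blast intro: free.span_base)
  then have span: "free.span (full_modular n ` Pow (nonempty_subsets n)) \<subseteq> ?V" for n
    by (intro free.span_minimal) auto
  have "polytope_basis n q \<in> ?V" if q: "hypergraphic n q" for n q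
  proof -
    let ?p = "family_polytope (supp_family n q)"
    have sub: "supp_family n q \<subseteq> nonempty_subsets n"
      by (rule supp_family_subset[OF q])
    have "polytope_basis n q - polytope_basis n ?p \<in> (simple_relations :: 'k polytope_comb set)"
      unfolding simple_relations_def
      using q hypergraphic_family_polytope[OF sub] supp_family_family_polytope[OF sub] by blast
    then have "polytope_basis n q - polytope_basis n ?p \<in> ?V"
      by (intro free.span_base) blast
    moreover have "polytope_basis n ?p \<in> ?V"
      using family_polytope_in_span_full_modular[OF sub] span by blast
    ultimately have "polytope_basis n q - polytope_basis n ?p + polytope_basis n ?p \<in> ?V"
      by (rule free.span_add)
    then show ?thesis
      by simp
  qed
  then show "HGP \<subseteq> ?V"
    unfolding HGP_eq_span by (intro free.span_minimal) auto
next
  have "full_modular n (orth_sets n \<pi>) \<in> (HGP :: 'k polytope_comb set)" for n \<pi>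
    unfolding full_modular_def using orth_sets_subset[of n \<pi>]
    by (subst modular_relation_eq)
      (auto intro!: free.subspace_sum[OF subspace_HGP] free.subspace_scale[OF subspace_HGP]
        polytope_basis_in_HGP hypergraphic_family_polytope)
  then have "realized_modulars \<subseteq> (HGP :: 'k polytope_comb set)"
    by (auto simp: realized_modulars_def)
  then show "free.span ((simple_relations \<union> modular_relations) \<union> realized_modulars)
      \<subseteq> (HGP :: 'k polytope_comb set)"
    using relations_in_kernel by (intro free.span_minimal[OF _ subspace_HGP]) blast
qed

lemma Upsilon_realized_modulars:
  "Upsilon ` realized_modulars = {N_series n \<pi> | n \<pi>. \<pi> \<in> set_compositions n}"
proof (intro equalityI subsetI)
  fix F assume "F \<in> Upsilon ` realized_modulars"
  then obtain n \<pi> where "\<pi> \<in> set_compositions n" "F = Upsilon (full_modular n (orth_sets n \<pi>))"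
    unfolding realized_modulars_def by blast
  then show "F \<in> {N_series n \<pi> | n \<pi>. \<pi> \<in> set_compositions n}"
    unfolding Upsilon_full_modular_orth_sets by blast
next
  fix F assume "F \<in> {N_series n \<pi> | n \<pi>. \<pi> \<in> set_compositions n}"
  then obtain n \<pi> where \<pi>: "\<pi> \<in> set_compositions n"
    and F: "F = Upsilon (full_modular n (orth_sets n \<pi>))"
    unfolding Upsilon_full_modular_orth_sets by blast
  have "full_modular n (orth_sets n \<pi>) \<in> realized_modulars"
    unfolding realized_modulars_def using \<pi> by blast
  then show "F \<in> Upsilon ` realized_modulars"
    unfolding F by (rule imageI)
qed

text \<open>
  Each realized modular relation has a word on which its image has coefficient 1 and the images of
  all the others have coefficient 0.
\<close>

lemma Upsilon_inj_on_span_realized: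
  assumes y: "y \<in> free.span realized_modulars" and 0: "Upsilon y = (0 :: 'k::field series)"
  shows "y = 0"
proof -
  obtain T r where T: "finite T" "T \<subseteq> realized_modulars" and y: "y = (\<Sum>t\<in>T. free_scale (r t) t)"
    using y unfolding free.span_explicit by blast
  have "r t = 0" if t: "t \<in> T" for t
  proof -
    obtain n \<pi> where n: "t = full_modular n (orth_sets n \<pi>)" "\<pi> \<in> set_compositions n"
      using t T by (auto simp: realized_modulars_def)
    \<comment> \<open>A coloring realizing \<open>\<pi>\<close> provides the word that detects
      \<open>t\<close>.\<close>
    obtain f where f: "f \<in> colorings n" "comp_of n f = \<pi>"
      using comp_of_surj[OF n(2)] by blast
    have "Upsilon s (word n f) = of_bool (s = t)" if s: "s \<in> T" for s
    proof -
      obtain m \<sigma> where m: "s = full_modular m (orth_sets m \<sigma>)"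
        using s T by (auto simp: realized_modulars_def)
      have s: "Upsilon s (word n f) = of_bool (n = m \<and> orth_sets m (comp_of m f) = orth_sets m \<sigma>)"
        unfolding m by (rule Upsilon_full_modular_word[OF orth_sets_subset f(1)])
      have t: "Upsilon t (word n f) = 1"
        unfolding n using Upsilon_full_modular_word[OF orth_sets_subset f(1), of n \<pi>] f by simp
      show ?thesis
      proof (cases "s = t")
        case True
        then show ?thesis
          using t by simp
      next
        case False
        \<comment> \<open>Equal degrees and equal families would make \<open>s\<close> and
          \<open>t\<close> the same transform, even for different \<open>\<sigma>\<close> and
          \<open>\<pi>\<close>.\<close>
        then have "\<not> (n = m \<and> orth_sets m (comp_of m f) = orth_sets m \<sigma>)"
          using m n f by auto
        then show ?thesis
          using False s by simp
      qed
    qed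
    then have "Upsilon y (word n f) = (\<Sum>s\<in>T. if s = t then r s else 0)"
      unfolding y by (auto simp: Upsilon.sum Upsilon.scale sum_fun_apply series_scale_def intro!: sum.cong)
    also have "\<dots> = r t"
      using T t by simp
    finally show ?thesis
      using 0 by simp
  qed
  then show ?thesis
    by (simp add: y)
qed

text \<open>Split a kernel element into a combination of relations and a part \<open>y\<close> in
  the span of the realized transforms. The relations map to 0, so \<open>y\<close> is in the kernel
  and vanishes by injectivity.\<close>

lemma kernel_Upsilon:
  "{v \<in> HGP. Upsilon v = (0 :: 'k::field series)}
    = free.span (simple_relations \<union> modular_relations)"
proof
  let ?R = "simple_relations \<union> modular_relations :: 'k polytope_comb set"
  have ker: "free.span ?R \<subseteq> {v \<in> HGP. Upsilon v = 0}"
  proof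
    fix v assume v: "v \<in> free.span ?R"
    have "v \<in> HGP"
      using v free.span_minimal[OF _ subspace_HGP, of ?R] relations_in_kernel by blast
    moreover have "Upsilon v = 0"
      by (rule Upsilon.eq_0_on_span[OF _ v]) (use relations_in_kernel in blast)
    ultimately show "v \<in> {v \<in> HGP. Upsilon v = 0}"
      by blast
  qed
  then show "free.span ?R \<subseteq> {v \<in> HGP. Upsilon v = 0}" .
  show "{v \<in> HGP. Upsilon v = 0} \<subseteq> free.span ?R"
  proof
    fix v assume v: "v \<in> {v \<in> HGP. Upsilon v = (0 :: 'k series)}"
    then obtain x y where xy: "v = x + y" "x \<in> free.span ?R" "y \<in> free.span realized_modulars"
      unfolding HGP_eq_span_relations free.span_Un[of ?R] by blast
    moreover have "Upsilon x = 0"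
      using ker xy(2) by blast
    ultimately have "Upsilon y = 0"
      using v by (simp add: Upsilon.add)
    then have "y = 0"
      using xy(3) by (rule Upsilon_inj_on_span_realized[rotated])
    then show "v \<in> free.span ?R"
      using xy by simp
  qed
qed

section \<open>The image\<close>

text \<open>The relations map to 0, and the realized transforms map onto the generators of
  \<open>SC\<close>.\<close>

lemma image_Upsilon: "Upsilon ` HGP = (SC :: 'k::field series set)"
proof
  have "Upsilon ` HGP = series.span (Upsilon ` (simple_relations \<union> modular_relations)
      \<union> {N_series n \<pi> :: 'k series | n \<pi>. \<pi> \<in> set_compositions n})"
    unfolding HGP_eq_span_relations Upsilon.span_image[symmetric] image_Un[of _ _ realized_modulars]
      Upsilon_realized_modulars ..
  also have "\<dots> \<subseteq> SC"
    unfolding SC_def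
  proof (rule series.span_minimal[OF _ series.subspace_span], rule Un_least)
    show "Upsilon ` (simple_relations \<union> modular_relations)
        \<subseteq> series.span {N_series n \<pi> :: 'k series | n \<pi>. \<pi> \<in> set_compositions n}"
    proof (rule image_subsetI)
      fix v :: "'k polytope_comb" assume "v \<in> simple_relations \<union> modular_relations"
      then have "Upsilon v = 0"
        using relations_in_kernel by blast
      then show "Upsilon v \<in> series.span {N_series n \<pi> :: 'k series | n \<pi>. \<pi> \<in> set_compositions n}"
        by (simp only: series.span_zero)
    qed
  qed (rule series.span_superset)
  finally show "Upsilon ` HGP \<subseteq> (SC :: 'k series set)" .
  have "SC = Upsilon ` free.span realized_modulars"
    by (simp add: SC_def Upsilon.span_image[symmetric] Upsilon_realized_modulars)
  also have "\<dots> \<subseteq> Upsilon ` HGP"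
    unfolding HGP_eq_span_relations by (intro image_mono free.span_mono) blast
  finally show "(SC :: 'k series set) \<subseteq> Upsilon ` HGP" .
qed

section \<open>Proper inclusion of \<open>SC\<close> in \<open>WQSym\<close>\<close>

lemma SC_subset_WQSym: "SC \<subseteq> WQSym"
  unfolding SC_def
proof (rule series.span_minimal)
  show "{N_series n \<pi> | n \<pi>. \<pi> \<in> set_compositions n} \<subseteq> (WQSym :: 'k::field series set)"
  proof clarify
    fix n \<pi>
    have "(N_series n \<pi> :: 'k series) \<in> WQSym_deg n"
      unfolding N_series_def WQSym_deg_def
      by (intro series.span_sum series.span_base) blast
    then show "(N_series n \<pi> :: 'k series) \<in> WQSym"
      unfolding WQSym_def by (blast intro: series.span_base)
  qed
qed (simp add: WQSym_def)

text \<open>Its composition is \<open>1|2\<close> for \<open>a < b\<close> and \<open>2|1\<close>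
  for \<open>b < a\<close>.\<close>

definition coloring2 :: "nat \<Rightarrow> nat \<Rightarrow> nat \<Rightarrow> nat" where
  "coloring2 a b = (\<lambda>i\<in>{1..2}. if i = 1 then a else b)"

lemma coloring2:
  assumes "0 < a" "0 < b"
  shows "coloring2 a b \<in> colorings 2" "word 2 (coloring2 a b) = [a, b]"
  using assms by (auto simp: colorings_def coloring2_def word_def upt_rec)

text \<open>Hence the series in \<open>SC\<close> cannot separate \<open>1|2\<close> from \<open>2|1\<close>.\<close>

lemma orth_sets_coloring2:
  assumes "a \<noteq> b"
  shows "orth_sets 2 (comp_of 2 (coloring2 a b)) = nonempty_subsets 2"
proof -
  have "card (argmins (coloring2 a b) A) = 1" if A: "A \<in> nonempty_subsets 2" for A
  proof -
    note A = nonempty_subsetsD[OF A]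
    \<comment> \<open>An injective coloring has a single minimizer on every nonempty set.\<close>
    have inj: "inj_on (coloring2 a b) A"
      using A assms by (intro inj_on_subset[OF _ A(3)]) (auto simp: inj_on_def coloring2_def)
    obtain j where j: "j \<in> argmins (coloring2 a b) A"
      using argmins_nonempty[OF A(1,2)] by blast
    then have "argmins (coloring2 a b) A = {j}"
      using inj by (auto simp: argmins_def inj_on_def)
    then show ?thesis
      by simp
  qed
  then show ?thesis
    by (auto simp: orth_sets_def first_part_comp_of)
qed

text \<open>In degree 2 a generator depends only on the orthogonal family, which is the same for
  both words; in other degrees it vanishes on words of length 2.\<close>

lemma SC_symmetric:
  assumes "F \<in> SC"
  shows "F [1, 2] = F [2, 1]"
  using assms unfolding SC_def
proof (induction rule: series.span_induct_alt)
  case (step c G F)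
  then obtain n \<pi> where G: "G = N_series n \<pi>"
    by blast
  have "G (word 2 (coloring2 1 2)) = G (word 2 (coloring2 2 1))"
    unfolding G by (cases "n = 2")
      (simp_all add: N_series_word coloring2(1) orth_sets_coloring2)
  then have "G [1, 2] = G [2, 1]"
    by (simp add: coloring2(2))
  then show ?case
    using step by (simp add: series_scale_def)
qed simp

lemma SC_psubset_WQSym: "(SC :: 'k::field series set) \<subset> WQSym"
proof -
  \<comment> \<open>This is \<open>1|2\<close>, whose monomial series contains the word
    \<open>[1, 2]\<close> but not \<open>[2, 1]\<close>.\<close>
  let ?\<pi> = "comp_of 2 (coloring2 1 2)"
  let ?M = "M_series 2 ?\<pi> :: 'k series"
  have "?M \<in> WQSym_deg 2"
    unfolding WQSym_deg_def by (intro series.span_base imageI comp_of_in_set_compositions)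
  then have "?M \<in> WQSym"
    unfolding WQSym_def by (blast intro: series.span_base)
  moreover have "?M \<notin> SC"
  proof
    assume "?M \<in> SC"
    then have "?M (word 2 (coloring2 1 2)) = ?M (word 2 (coloring2 2 1))"
      using SC_symmetric[of ?M] by (simp add: coloring2(2))
    then have "comp_of 2 (coloring2 2 1) = ?\<pi>"
      by (simp add: M_series_word coloring2(1) split: if_splits)
    \<comment> \<open>The first part of \<open>{1, 2}\<close> tells the two compositions
      apart.\<close>
    then have "argmins (coloring2 2 1) {1, 2} = argmins (coloring2 1 2) {1, 2}"
      using first_part_comp_of[of "{1, 2}" 2 "coloring2 2 1"]
        first_part_comp_of[of "{1, 2}" 2 "coloring2 1 2"]
      by (simp add: nonempty_subsets_def)
    moreover have "argmins (coloring2 2 1) {1, 2} = {2}" "argmins (coloring2 1 2) {1, 2} = {1}"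
      by (auto simp: argmins_def coloring2_def)
    ultimately show False
      by simp
  qed
  ultimately show ?thesis
    using SC_subset_WQSym by blast
qed

theorem theorem3:
  shows "{v \<in> HGP. Upsilon v = (0 :: 'k::field_char_0 series)}
           = free.span (simple_relations \<union> modular_relations)
       \<and> Upsilon ` HGP = (SC :: 'k series set)
       \<and> series.subspace (SC :: 'k series set)
       \<and> (SC :: 'k series set) \<subset> WQSym"
  using kernel_Upsilon image_Upsilon SC_psubset_WQSym by (auto simp: SC_def)

end
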